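(* Let $A\in\mathbb{R}^{n\times n}$ and $C\in\mathbb{R}^{n_y\times n}$ with $(A,C)$ observable, and consider the system $\dot x(t)=Ax(t)$, $y(t)=Cx(t)$. Let $\alpha>0$, $G=-\alpha I\in\mathbb{R}^{n\times n}$, $L,E,N_c\in\mathbb{R}^{n\times n_y}$ and $\theta=\theta^T\ge 0$ in $\mathbb{R}^{n_y\times n_y}$. Consider the linear observer $$\dot w_l(t)=Gw_l(t)+Ly(t),\qquad \hat x_l(t)=w_l(t)+Ey(t),$$ with error $e_l(t)=x(t)-\hat x_l(t)$, and the cubic observer with the same $G,L,E$, $$\dot w_c(t)=Gw_c(t)+Ly(t)-\big(e_c^T(t)C^T\theta Ce_c(t)\big)N_cCe_c(t),\qquad \hat x_c(t)=w_c(t)+Ey(t),$$ with error $e_c(t)=x(t)-\hat x_c(t)$. Suppose that (i) $(I-EC)A-G(I-EC)-LC=0$; (ii) there is no vector $v\in\mathbb{R}^n$, $v\neq 0$, with $Gv+(v^TC^T\theta Cv)N_cCv=0$; (iii) $P=P^T>0$ is a matrix in $\mathbb{R}^{n\times n}$ such that $G^TP+PG<0$ and $PN_cC+C^TN_c^TP<0$. Then $$e_c^T(0)Pe_c(0)\le e_l^T(0)Pe_l(0)\ \Longrightarrow\ e_c^T(t)Pe_c(t)\le e_l^T(t)Pe_l(t)\quad\text{for all } t>0.$$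
   Context: Matrix inequalities such as $M>0$, $M\ge 0$, $M<0$ are in the sense of (semi)definiteness of symmetric matrices. *)

theory Defs
  imports "HOL-Analysis.Analysis"
begin

text \<open>Definiteness is understood for symmetric matrices, so symmetry is part of each predicate.\<close>

definition pos_def :: "real ^ 'n ^ 'n \<Rightarrow> bool" where
  "pos_def M \<longleftrightarrow> transpose M = M \<and> (\<forall>v. v \<noteq> 0 \<longrightarrow> v \<bullet> (M *v v) > 0)"

definition pos_semidef :: "real ^ 'n ^ 'n \<Rightarrow> bool" where
  "pos_semidef M \<longleftrightarrow> transpose M = M \<and> (\<forall>v. v \<bullet> (M *v v) \<ge> 0)"

definition neg_def :: "real ^ 'n ^ 'n \<Rightarrow> bool" where
  "neg_def M \<longleftrightarrow> transpose M = M \<and> (\<forall>v. v \<noteq> 0 \<longrightarrow> v \<bullet> (M *v v) < 0)"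

text \<open>Observability of \<open>x' = A x\<close>, \<open>y = C x\<close>: the output on some finite time interval
  determines the initial state uniquely. Derivatives at the endpoints are one-sided.\<close>

definition observable :: "real ^ 'n ^ 'n \<Rightarrow> real ^ 'n ^ 'm \<Rightarrow> bool" where
  "observable A C \<longleftrightarrow>
    (\<exists>T>0. \<forall>x\<^sub>1 x\<^sub>2.
      (\<forall>t\<in>{0..T}. (x\<^sub>1 has_vector_derivative A *v x\<^sub>1 t) (at t within {0..T})) \<longrightarrow>
      (\<forall>t\<in>{0..T}. (x\<^sub>2 has_vector_derivative A *v x\<^sub>2 t) (at t within {0..T})) \<longrightarrow>
      (\<forall>t\<in>{0..T}. C *v x\<^sub>1 t = C *v x\<^sub>2 t) \<longrightarrow> x\<^sub>1 0 = x\<^sub>2 0)"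

end

theory Submission
  imports Defs
begin

text \<open>
  Put \<open>V e = e \<bullet> P e\<close>. The matching condition (i) cancels the plant state from both error
  equations: the linear error obeys \<open>e\<^sub>l' = G e\<^sub>l\<close>, and the cubic one
  \<open>e\<^sub>c' = G e\<^sub>c + q N\<^sub>c C e\<^sub>c\<close> with the scalar \<open>q = e\<^sub>c \<bullet> C\<^sup>T \<theta> C e\<^sub>c \<ge> 0\<close>.

  Since \<open>G = - \<alpha> I\<close>, the linear part contributes exactly \<open>- 2 \<alpha> V\<close> to the rate of \<open>V\<close>,
  whatever the direction of the error; so \<open>V\<close> along the linear error solves
  \<open>v' = - 2 \<alpha> v\<close>, while along the cubic error it satisfies \<open>v' \<le> - 2 \<alpha> v\<close>, the additional term
  \<open>q e\<^sub>c \<bullet> (P N\<^sub>c C + C\<^sup>T N\<^sub>c\<^sup>T P) e\<^sub>c\<close> being nonpositive. Thus the difference \<open>D\<close> of the two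
  satisfies \<open>D' \<le> - 2 \<alpha> D\<close>, and the comparison principle
  \<open>differential_inequality_exp_bound\<close> gives \<open>D t \<le> exp (- 2 \<alpha> t) D 0 \<le> 0\<close>.
  That the linear part scales \<open>V\<close> by the same factor in every direction is what allows error
  trajectories with different starting points to be compared.
\<close>

lemma quadratic_form_add_transpose:
  fixes M :: "real ^ 'n ^ 'n"
  shows "v \<bullet> ((M + transpose M) *v v) = 2 * (v \<bullet> (M *v v))"
  by (simp add: matrix_vector_mult_add_rdistrib inner_add_right dot_lmul_matrix
      vector_transpose_matrix inner_commute flip: dot_lmul_matrix)

lemma has_real_derivative_quadratic_form:
  fixes P :: "real ^ 'n ^ 'n" and e :: "real \<Rightarrow> real ^ 'n"
  assumes "transpose P = P" and e: "(e has_vector_derivative d) (at t within S)"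
  shows "((\<lambda>s. e s \<bullet> (P *v e s)) has_real_derivative 2 * (e t \<bullet> (P *v d))) (at t within S)"
proof -
  have "d \<bullet> (P *v e t) = e t \<bullet> (P *v d)"
    using assms(1) by (metis dot_lmul_matrix inner_commute vector_transpose_matrix)
  moreover have "((\<lambda>s. P *v e s) has_vector_derivative P *v d) (at t within S)"
    by (rule bounded_linear.has_vector_derivative[OF matrix_vector_mul_bounded_linear e])
  ultimately show ?thesis
    using bounded_bilinear.has_vector_derivative[OF bounded_bilinear_inner e]
    by (force simp: has_real_derivative_iff_has_vector_derivative)
qed

text \<open>This is the scalar in front of the cubic injection. Being the \<open>\<theta>\<close>-weighted square of
  the output \<open>C v\<close>, it is never negative and so cannot turn the dissipation caused by
  \<open>N\<^sub>c\<close> into growth.\<close>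

lemma pos_semidef_congruence_nonneg:
  fixes C :: "real ^ 'n ^ 'm"
  assumes "pos_semidef \<theta>"
  shows "v \<bullet> ((transpose C ** \<theta> ** C) *v v) \<ge> 0"
proof -
  have "v \<bullet> ((transpose C ** \<theta> ** C) *v v) = (C *v v) \<bullet> (\<theta> *v (C *v v))"
    by (metis matrix_vector_mul_assoc dot_lmul_matrix vector_transpose_matrix)
  then show ?thesis
    using assms by (simp add: pos_semidef_def)
qed

text \<open>Multiplying by the integrating factor \<open>exp (- k t)\<close> turns the inequality into
  monotonicity.\<close>

lemma differential_inequality_exp_bound:
  fixes f f' :: "real \<Rightarrow> real"
  assumes f: "\<And>s. s \<ge> 0 \<Longrightarrow> (f has_real_derivative f' s) (at s within {0..})"
    and le: "\<And>s. s \<ge> 0 \<Longrightarrow> f' s \<le> k * f s"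
    and t: "t \<ge> 0"
  shows "f t \<le> exp (k * t) * f 0"
proof -
  define g where "g s = exp (- k * s) * f s" for s
  have g: "(g has_real_derivative exp (- k * s) * (f' s - k * f s)) (at s within {0..})"
    if "s \<ge> 0" for s
    unfolding g_def using f[OF that]
    by (auto intro!: derivative_eq_intros simp: algebra_simps)
  have "g t \<le> g 0"
  proof (rule DERIV_nonpos_imp_decreasing_open[OF t])
    fix s assume s: "0 < s" "s < t"
    then have "at s within {0..} = at s"
      by (intro at_within_interior) (simp add: interior_Ici[of "-1"])
    then have "(g has_real_derivative exp (- k * s) * (f' s - k * f s)) (at s)"
      using g[of s] s by simp
    moreover have "exp (- k * s) * (f' s - k * f s) \<le> 0"
      using le[of s] s by (intro mult_nonneg_nonpos) auto
    ultimately show "\<exists>z. DERIV g s :> z \<and> z \<le> 0" by blast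
  next
    have "continuous_on {0..} g"
      unfolding continuous_on_eq_continuous_within using g by (auto intro: DERIV_continuous)
    then show "continuous_on {0..t} g"
      by (rule continuous_on_subset) auto
  qed
  then have "exp (k * t) * g t \<le> exp (k * t) * f 0"
    by (simp add: g_def)
  moreover have "exp (k * t) * g t = f t"
    by (simp add: g_def exp_minus)
  ultimately show ?thesis by simp
qed

text \<open>The error is \<open>(I - E C) x - w\<close>, and the matching condition says precisely that
  \<open>(I - E C) A x - L C x = G (I - E C) x\<close>, so that \<open>x\<close> appears in the derivative only through
  the error itself. The term \<open>u\<close> is the additional injection: zero for the linear
  observer, cubic in the error for the other one.\<close>

lemma observer_error_dynamics:
  fixes A G :: "real ^ 'n ^ 'n" and C :: "real ^ 'n ^ 'm" and L E :: "real ^ 'm ^ 'n"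
    and x w e :: "real \<Rightarrow> real ^ 'n"
  assumes match: "(mat 1 - E ** C) ** A - G ** (mat 1 - E ** C) - L ** C = 0"
    and x: "(x has_vector_derivative A *v x t) (at t within S)"
    and w: "(w has_vector_derivative G *v w t + L *v (C *v x t) - u) (at t within S)"
    and e: "\<And>s. s \<in> S \<Longrightarrow> e s = x s - (w s + E *v (C *v x s))"
    and t: "t \<in> S"
  shows "(e has_vector_derivative G *v e t + u) (at t within S)"
proof -
  let ?T = "mat 1 - E ** C"
  have e_alt: "e s = ?T *v x s - w s" if "s \<in> S" for s
    using e[OF that]
    by (simp add: matrix_vector_mult_diff_rdistrib matrix_vector_mul_assoc)
  have "((\<lambda>s. ?T *v x s - w s) has_vector_derivative
      ?T *v (A *v x t) - (G *v w t + L *v (C *v x t) - u)) (at t within S)"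
    by (intro has_vector_derivative_diff w
        bounded_linear.has_vector_derivative[OF matrix_vector_mul_bounded_linear x])
  moreover have "?T *v (A *v x t) - (G *v w t + L *v (C *v x t) - u) = G *v e t + u"
  proof -
    have "((?T ** A - G ** ?T) - L ** C) *v x t = 0"
      using match by simp
    then have "?T *v (A *v x t) - G *v (?T *v x t) - L *v (C *v x t) = 0"
      unfolding matrix_vector_mult_diff_rdistrib[of "?T ** A - G ** ?T"]
        matrix_vector_mult_diff_rdistrib[of "?T ** A"] matrix_vector_mul_assoc .
    then show ?thesis
      unfolding e_alt[OF t] matrix_vector_mult_diff_distrib by (simp add: algebra_simps)
  qed
  ultimately have "((\<lambda>s. ?T *v x s - w s) has_vector_derivative G *v e t + u) (at t within S)"
    by simp
  then show ?thesis
    by (rule has_vector_derivative_transform[OF t, rotated]) (rule e_alt)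
qed

text \<open>For a scalar matrix the rate of the quadratic form under the linear part is a multiple of
  the form itself; for other matrices the ratio of the two can depend on the direction of \<open>v\<close>.\<close>

lemma quadratic_form_scalar_rate:
  fixes P :: "real ^ 'n ^ 'n"
  shows "2 * (v \<bullet> (P *v ((- (\<alpha> *\<^sub>R mat 1)) *v v + u)))
    = - (2 * \<alpha>) * (v \<bullet> (P *v v)) + 2 * (v \<bullet> (P *v u))"
proof -
  have "(- (\<alpha> *\<^sub>R mat 1)) *v v = (- \<alpha>) *\<^sub>R v"
    by (metis matrix_vector_mul_lid scaleR_matrix_vector_assoc scaleR_minus_left)
  then show ?thesis
    by (simp only: matrix_vector_right_distrib matrix_vector_mult_scaleR inner_add_right
        inner_scaleR_right) (simp add: algebra_simps)
qed

theorem theorem3: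
  fixes A G P :: "real ^ 'n ^ 'n"
    and C :: "real ^ 'n ^ 'm"
    and L E N\<^sub>c :: "real ^ 'm ^ 'n"
    and \<theta> :: "real ^ 'm ^ 'm"
    and \<alpha> :: real
    and x w\<^sub>l w\<^sub>c xhat\<^sub>l xhat\<^sub>c e\<^sub>l e\<^sub>c :: "real \<Rightarrow> real ^ 'n"
    and y :: "real \<Rightarrow> real ^ 'm"
  assumes "observable A C"
    and "\<alpha> > 0"
    and "G = - (\<alpha> *\<^sub>R mat 1)"
    and "pos_semidef \<theta>"
    and x: "\<And>t. t \<ge> 0 \<Longrightarrow> (x has_vector_derivative A *v x t) (at t within {0..})"
    and y: "\<And>t. t \<ge> 0 \<Longrightarrow> y t = C *v x t"
    and w\<^sub>l: "\<And>t. t \<ge> 0 \<Longrightarrow>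
      (w\<^sub>l has_vector_derivative G *v w\<^sub>l t + L *v y t) (at t within {0..})"
    and xhat\<^sub>l: "\<And>t. t \<ge> 0 \<Longrightarrow> xhat\<^sub>l t = w\<^sub>l t + E *v y t"
    and e\<^sub>l: "\<And>t. t \<ge> 0 \<Longrightarrow> e\<^sub>l t = x t - xhat\<^sub>l t"
    and w\<^sub>c: "\<And>t. t \<ge> 0 \<Longrightarrow>
      (w\<^sub>c has_vector_derivative
        G *v w\<^sub>c t + L *v y t
          - (e\<^sub>c t \<bullet> ((transpose C ** \<theta> ** C) *v e\<^sub>c t)) *\<^sub>R ((N\<^sub>c ** C) *v e\<^sub>c t))
        (at t within {0..})"
    and xhat\<^sub>c: "\<And>t. t \<ge> 0 \<Longrightarrow> xhat\<^sub>c t = w\<^sub>c t + E *v y t"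
    and e\<^sub>c: "\<And>t. t \<ge> 0 \<Longrightarrow> e\<^sub>c t = x t - xhat\<^sub>c t"
    and "(mat 1 - E ** C) ** A - G ** (mat 1 - E ** C) - L ** C = 0"
    and "\<not> (\<exists>v. v \<noteq> 0 \<and>
      G *v v + (v \<bullet> ((transpose C ** \<theta> ** C) *v v)) *\<^sub>R ((N\<^sub>c ** C) *v v) = 0)"
    and "pos_def P"
    and "neg_def (transpose G ** P + P ** G)"
    and "neg_def (P ** N\<^sub>c ** C + transpose C ** transpose N\<^sub>c ** P)"
  shows "e\<^sub>c 0 \<bullet> (P *v e\<^sub>c 0) \<le> e\<^sub>l 0 \<bullet> (P *v e\<^sub>l 0) \<longrightarrow>
    (\<forall>t>0. e\<^sub>c t \<bullet> (P *v e\<^sub>c t) \<le> e\<^sub>l t \<bullet> (P *v e\<^sub>l t))"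
proof (intro impI allI)
  fix t :: real
  assume init: "e\<^sub>c 0 \<bullet> (P *v e\<^sub>c 0) \<le> e\<^sub>l 0 \<bullet> (P *v e\<^sub>l 0)" and t: "t > 0"
  define q where "q s = e\<^sub>c s \<bullet> ((transpose C ** \<theta> ** C) *v e\<^sub>c s)" for s
  define u where "u s = q s *\<^sub>R ((N\<^sub>c ** C) *v e\<^sub>c s)" for s
  note match = assms(13)
  have P: "transpose P = P"
    using \<open>pos_def P\<close> by (simp add: pos_def_def)

  have dl: "(e\<^sub>l has_vector_derivative G *v e\<^sub>l s + 0) (at s within {0..})" if "s \<ge> 0" for s
    by (rule observer_error_dynamics[OF match x[OF that]])
      (use w\<^sub>l[OF that] y e\<^sub>l xhat\<^sub>l that in auto)
  have dc: "(e\<^sub>c has_vector_derivative G *v e\<^sub>c s + u s) (at s within {0..})" if "s \<ge> 0" for s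
    by (rule observer_error_dynamics[OF match x[OF that]])
      (use w\<^sub>c[OF that] y e\<^sub>c xhat\<^sub>c that in \<open>auto simp: u_def q_def\<close>)

  \<comment> \<open>Only the symmetric part of \<open>P N\<^sub>c C\<close> counts in the form, and the matrix assumed
    negative definite is twice that part.\<close>
  have cubic: "e\<^sub>c s \<bullet> (P *v u s) \<le> 0" for s
  proof -
    have "P ** N\<^sub>c ** C + transpose C ** transpose N\<^sub>c ** P
        = P ** N\<^sub>c ** C + transpose (P ** N\<^sub>c ** C)"
      by (simp add: matrix_transpose_mul P matrix_mul_assoc)
    then have "2 * (e\<^sub>c s \<bullet> ((P ** N\<^sub>c ** C) *v e\<^sub>c s))
        = e\<^sub>c s \<bullet> ((P ** N\<^sub>c ** C + transpose C ** transpose N\<^sub>c ** P) *v e\<^sub>c s)"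
      by (simp only: quadratic_form_add_transpose)
    also have "\<dots> \<le> 0"
      using assms(17) unfolding neg_def_def by (cases "e\<^sub>c s = 0") (auto intro: less_imp_le)
    finally have "e\<^sub>c s \<bullet> ((P ** N\<^sub>c ** C) *v e\<^sub>c s) \<le> 0"
      by simp
    moreover have "q s \<ge> 0"
      unfolding q_def by (rule pos_semidef_congruence_nonneg[OF \<open>pos_semidef \<theta>\<close>])
    moreover have "e\<^sub>c s \<bullet> (P *v u s) = q s * (e\<^sub>c s \<bullet> ((P ** N\<^sub>c ** C) *v e\<^sub>c s))"
      by (simp add: u_def matrix_vector_mult_scaleR matrix_vector_mul_assoc matrix_mul_assoc)
    ultimately show ?thesis
      by (simp add: mult_nonneg_nonpos)
  qed

  define D where "D s = e\<^sub>c s \<bullet> (P *v e\<^sub>c s) - e\<^sub>l s \<bullet> (P *v e\<^sub>l s)" for s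
  have "D t \<le> exp (- (2 * \<alpha>) * t) * D 0"
  proof (rule differential_inequality_exp_bound)
    fix s :: real assume s: "s \<ge> 0"
    show "(D has_real_derivative
        2 * (e\<^sub>c s \<bullet> (P *v (G *v e\<^sub>c s + u s))) - 2 * (e\<^sub>l s \<bullet> (P *v (G *v e\<^sub>l s + 0))))
        (at s within {0..})"
      unfolding D_def
      by (intro DERIV_diff has_real_derivative_quadratic_form[OF P] dc[OF s] dl[OF s])
    show "2 * (e\<^sub>c s \<bullet> (P *v (G *v e\<^sub>c s + u s))) - 2 * (e\<^sub>l s \<bullet> (P *v (G *v e\<^sub>l s + 0)))
        \<le> - (2 * \<alpha>) * D s"
      unfolding \<open>G = _\<close> quadratic_form_scalar_rate D_def
      using cubic[of s] by (simp add: algebra_simps)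
  qed (use t in simp)
  also have "\<dots> \<le> 0"
    using init by (intro mult_nonneg_nonpos) (auto simp: D_def)
  finally show "e\<^sub>c t \<bullet> (P *v e\<^sub>c t) \<le> e\<^sub>l t \<bullet> (P *v e\<^sub>l t)"
    by (simp add: D_def)
qed

end
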